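(* Consider an LP solver which, among all optimal extreme point solutions of a node LP, reports one with a maximal number of fractional components. For a vertex cover instance $\mathcal{I}$, let $\mathcal{T}_S(\mathcal{I})$ and $\mathcal{T}_G(\mathcal{I})$ be any branch-and-bound trees solving $\mathcal{I}$ (with this LP solver and worst-bound node selection) obtained using the strong-branching rule (product score) and the greedy rule, respectively. Then there is a family of vertex cover instances $\mathcal{I}^*$ on $n$ vertices (with $n\to\infty$) such that $$|\mathcal{T}_G(\mathcal{I}^* )|\ge 2^{\Omega(n)}\cdot|\mathcal{T}_S(\mathcal{I}^* )| \quad\text{and}\quad |\mathcal{T}_G(\mathcal{I}^* )|\ge 2^{c\cdot\Gamma(\mathcal{I}^* )}$$ for some constant $c>2$.
   Context: Vertex cover IP for a graph $G=(V,E)$, $n=|V|$: minimize $\sum_v x_v$ subject to $x_u+x_v\ge1$ ($uv\in E$), $x\in\{0,1\}^V$; LP relaxation uses $x\in[0,1]^V$; $\Gamma(\mathcal{I})$ is the IP optimal value minus the LP optimal value. Branch-and-bound: nodes are the LP relaxation plus fixings $x_j\in\{0\}$ or $\{1\}$; a node is pruned if infeasible, if the returned solution is integral, or if its LP value is strictly larger than that of an integral solution already found; worst-bound node selection processes an open node of smallest LP value; $|\mathcal{T}|$ is the number of nodes. Strong branching with product score: at node $N$ with LP value $z$ and returned solution $\hat x$, for each $j$ with $\hat x_j$ fractional compute children's LP values $z^0_j,z^1_j$ ($+\infty$ if infeasible), $\Delta^-_j=z^0_j-z$, $\Delta^+_j=z^1_j-z$, and branch on a maximizer of $\Delta^+_j\Delta^-_j$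 (with $0\cdot\infty=0$). Greedy rule: branch on a vertex $v$ with $\hat x_v$ fractional having the largest number of neighbours $u$ with $\hat x_u$ fractional. *)

theory Defs
  imports Complex_Main "HOL-Library.Extended_Real"
begin

definition vc_graph :: "nat \<Rightarrow> nat set set \<Rightarrow> bool" where
  "vc_graph n E \<longleftrightarrow> (\<forall>e\<in>E. card e = 2 \<and> e \<subseteq> {..<n})"

text \<open>Fixings of a branch-and-bound node: None = free, Some False = fixed to 0,
  Some True = fixed to 1.\<close>
type_synonym fixing = "nat \<Rightarrow> bool option"

definition lp_feas :: "nat \<Rightarrow> nat set set \<Rightarrow> fixing \<Rightarrow> (nat \<Rightarrow> real) set" where
  "lp_feas n E F = {x. (\<forall>v. n \<le> v \<longrightarrow> x v = 0)
       \<and> (\<forall>v<n. 0 \<le> x v \<and> x v \<le> 1)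
       \<and> (\<forall>e\<in>E. \<forall>u\<in>e. \<forall>v\<in>e. u \<noteq> v \<longrightarrow> x u + x v \<ge> 1)
       \<and> (\<forall>v<n. F v = Some False \<longrightarrow> x v = 0)
       \<and> (\<forall>v<n. F v = Some True \<longrightarrow> x v = 1)}"

definition obj :: "nat \<Rightarrow> (nat \<Rightarrow> real) \<Rightarrow> real" where
  "obj n x = (\<Sum>v<n. x v)"

text \<open>LP value of a node (+infinity if infeasible).\<close>
definition lp_val :: "nat \<Rightarrow> nat set set \<Rightarrow> fixing \<Rightarrow> ereal" where
  "lp_val n E F = (INF x\<in>lp_feas n E F. ereal (obj n x))"

definition integral :: "nat \<Rightarrow> (nat \<Rightarrow> real) \<Rightarrow> bool" where
  "integral n x \<longleftrightarrow> (\<forall>v<n. x v = 0 \<or> x v = 1)"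

definition ip_val :: "nat \<Rightarrow> nat set set \<Rightarrow> ereal" where
  "ip_val n E = (INF x\<in>{x\<in>lp_feas n E (\<lambda>_. None). integral n x}. ereal (obj n x))"

definition gap :: "nat \<Rightarrow> nat set set \<Rightarrow> real" where
  "gap n E = real_of_ereal (ip_val n E) - real_of_ereal (lp_val n E (\<lambda>_. None))"

definition extreme_pt :: "(nat \<Rightarrow> real) set \<Rightarrow> (nat \<Rightarrow> real) \<Rightarrow> bool" where
  "extreme_pt S x \<longleftrightarrow> x \<in> S \<and>
     \<not> (\<exists>y\<in>S. \<exists>z\<in>S. y \<noteq> z \<and> (\<exists>t::real. 0 < t \<and> t < 1 \<and> x = (\<lambda>v. t * y v + (1 - t) * z v)))"

definition lp_optimal :: "nat \<Rightarrow> nat set set \<Rightarrow> fixing \<Rightarrow> (nat \<Rightarrow> real) \<Rightarrow> bool" where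
  "lp_optimal n E F x \<longleftrightarrow> x \<in> lp_feas n E F \<and> (\<forall>y\<in>lp_feas n E F. obj n x \<le> obj n y)"

definition frac :: "(nat \<Rightarrow> real) \<Rightarrow> nat \<Rightarrow> bool" where
  "frac x v \<longleftrightarrow> 0 < x v \<and> x v < 1"

definition nfrac :: "nat \<Rightarrow> (nat \<Rightarrow> real) \<Rightarrow> nat" where
  "nfrac n x = card {v. v < n \<and> frac x v}"

definition solver_ok :: "nat \<Rightarrow> nat set set \<Rightarrow> fixing \<Rightarrow> (nat \<Rightarrow> real) \<Rightarrow> bool" where
  "solver_ok n E F x \<longleftrightarrow> lp_optimal n E F x \<and> extreme_pt (lp_feas n E F) x \<and>
     (\<forall>y. lp_optimal n E F y \<and> extreme_pt (lp_feas n E F) y \<longrightarrow> nfrac n y \<le> nfrac n x)"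

text \<open>Branching rules: rule n E F x j holds iff j is an admissible branching
  variable at the node with fixings F whose returned LP solution is x.\<close>
type_synonym brule = "nat \<Rightarrow> nat set set \<Rightarrow> fixing \<Rightarrow> (nat \<Rightarrow> real) \<Rightarrow> nat \<Rightarrow> bool"

definition sb_score :: "nat \<Rightarrow> nat set set \<Rightarrow> fixing \<Rightarrow> nat \<Rightarrow> ereal" where
  "sb_score n E F j = (lp_val n E (F(j := Some False)) - lp_val n E F)
                    * (lp_val n E (F(j := Some True)) - lp_val n E F)"

text \<open>Strong branching with product score (ereal arithmetic: 0 * infinity = 0).\<close>
definition strong_rule :: brule where
  "strong_rule n E F x j \<longleftrightarrow> j < n \<and> frac x j \<and>
     (\<forall>i<n. frac x i \<longrightarrow> sb_score n E F i \<le> sb_score n E F j)"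

definition frac_nbrs :: "nat \<Rightarrow> nat set set \<Rightarrow> (nat \<Rightarrow> real) \<Rightarrow> nat \<Rightarrow> nat" where
  "frac_nbrs n E x v = card {u. u < n \<and> {v, u} \<in> E \<and> frac x u}"

definition greedy_rule :: brule where
  "greedy_rule n E F x j \<longleftrightarrow> j < n \<and> frac x j \<and>
     (\<forall>i<n. frac x i \<longrightarrow> frac_nbrs n E x i \<le> frac_nbrs n E x j)"

text \<open>Branch-and-bound state: open nodes, incumbent value, number of processed nodes.
  One step: select an open node of smallest LP value (worst bound), solve it, and
  prune (infeasible / integral solution / LP value strictly above incumbent) or branch.\<close>
type_synonym bb_state = "fixing set \<times> ereal \<times> nat"

definition bb_step :: "nat \<Rightarrow> nat set set \<Rightarrow> brule \<Rightarrow> bb_state \<Rightarrow> bb_state \<Rightarrow> bool" where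
  "bb_step n E rule s s' \<longleftrightarrow>
     (case s of (Op, U, c) \<Rightarrow>
       (\<exists>F\<in>Op. (\<forall>G\<in>Op. lp_val n E F \<le> lp_val n E G) \<and>
         (let z = lp_val n E F; O0 = Op - {F} in
           (z = \<infinity> \<and> s' = (O0, U, Suc c)) \<or>
           (z \<noteq> \<infinity> \<and> (\<exists>x. solver_ok n E F x \<and>
              ((integral n x \<and> s' = (O0, min U z, Suc c)) \<or>
               (\<not> integral n x \<and> U < z \<and> s' = (O0, U, Suc c)) \<or>
               (\<not> integral n x \<and> \<not> U < z \<and>
                  (\<exists>j. rule n E F x j \<and>
                     s' = (O0 \<union> {F(j := Some False), F(j := Some True)}, U, Suc c)))))))))"

text \<open>bb_tree n E rule t: some branch-and-bound run (worst-bound selection, the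
  above LP solver, the given branching rule) solves the instance with a tree of t nodes.\<close>
definition bb_tree :: "nat \<Rightarrow> nat set set \<Rightarrow> brule \<Rightarrow> nat \<Rightarrow> bool" where
  "bb_tree n E rule t \<longleftrightarrow>
     (\<exists>U. (bb_step n E rule)\<^sup>*\<^sup>* ({\<lambda>_. None}, \<infinity>, 0) ({}, U, t))"

end

theory Submission
  imports Defs
begin

text \<open>The instance consists of \<open>m\<close> disjoint copies of a triangle with a hub of degree 4 attached to
  one of its vertices; a copy has LP value 9/2 and IP value 5. Fixing a triangle vertex either way
  costs 1/2 and leaves a bipartite graph, on which extreme points are integral. Fixing the hub to 0
  also costs 1/2 and resolves the copy, but fixing it to 1 is free and leaves the triangle
  fractional. Strong branching sees product score 1/4 at the triangle and 0 elsewhere, so every copy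
  contributes a factor 2 to its leaves. The greedy rule takes the hub first, so every copy
  contributes a factor 3. The trees have \<open>2 * 2^m - 1\<close> and \<open>2 * 3^m - 1\<close> nodes, and the gap is
  \<open>m / 2\<close>.\<close>

section \<open>Size of branch-and-bound trees\<close>

definition incompat :: "fixing \<Rightarrow> fixing \<Rightarrow> bool" where
  "incompat F G \<longleftrightarrow> (\<exists>v a b. F v = Some a \<and> G v = Some b \<and> a \<noteq> b)"

lemma incompat_sym: "incompat F G \<Longrightarrow> incompat G F"
  unfolding incompat_def by metis

lemma incompat_irrefl: "\<not> incompat F F"
  unfolding incompat_def by auto

lemma incompat_upd: "incompat F G \<Longrightarrow> F j = None \<Longrightarrow> incompat (F(j := b)) G"
  unfolding incompat_def by (metis fun_upd_other option.distinct(1))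

text \<open>\<open>W F\<close> is the number of leaves below \<open>F\<close>. Open nodes stay pairwise incompatible, so no node is
  lost when the children are added to the set of open nodes.\<close>

lemma bb_tree_size:
  fixes W :: "fixing \<Rightarrow> nat" and opt :: ereal
  assumes root: "Good (\<lambda>_. None)"
    and opt: "opt \<noteq> \<infinity>"
    and le_opt: "\<And>F. Good F \<Longrightarrow> lp_val n E F \<le> opt"
    and leaf: "\<And>F x. Good F \<Longrightarrow> solver_ok n E F x \<Longrightarrow> integral n x \<Longrightarrow>
        W F = 1 \<and> lp_val n E F = opt"
    and branch: "\<And>F x j. Good F \<Longrightarrow> solver_ok n E F x \<Longrightarrow> \<not> integral n x \<Longrightarrow> rule n E F x j \<Longrightarrow>
        F j = None \<and> (\<forall>b. Good (F(j := Some b))) \<and>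
        W (F(j := Some False)) + W (F(j := Some True)) = W F"
    and tree: "bb_tree n E rule t"
  shows "t + 1 = 2 * W (\<lambda>_. None)"
proof -
  \<comment> \<open>A binary tree with \<open>W F\<close> leaves has \<open>2 * W F - 1\<close>
    nodes, so the processed nodes plus the subtrees below the open nodes form a constant total.
    Integers avoid truncated subtraction.\<close>
  define I :: "bb_state \<Rightarrow> bool" where
    "I = (\<lambda>(Op, U, c). finite Op \<and> (\<forall>F\<in>Op. Good F) \<and> opt \<le> U \<and>
       (\<forall>F\<in>Op. \<forall>G\<in>Op. F \<noteq> G \<longrightarrow> incompat F G) \<and>
       int c + (\<Sum>F\<in>Op. 2 * int (W F) - 1) = 2 * int (W (\<lambda>_. None)) - 1)"
  have step: "I s'" if "I s" and st: "bb_step n E rule s s'" for s s'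
  proof -
    obtain Op U c where s: "s = (Op, U, c)" by (cases s) auto
    have fin: "finite Op" and good: "\<forall>F\<in>Op. Good F" and U: "opt \<le> U"
      and inc: "\<forall>F\<in>Op. \<forall>G\<in>Op. F \<noteq> G \<longrightarrow> incompat F G"
      and cnt: "int c + (\<Sum>F\<in>Op. 2 * int (W F) - 1) = 2 * int (W (\<lambda>_. None)) - 1"
      using \<open>I s\<close> by (simp_all add: I_def s)
    obtain F where F: "F \<in> Op" and cases: "lp_val n E F = \<infinity> \<and> s' = (Op - {F}, U, Suc c) \<or>
         lp_val n E F \<noteq> \<infinity> \<and> (\<exists>x. solver_ok n E F x \<and>
              ((integral n x \<and> s' = (Op - {F}, min U (lp_val n E F), Suc c)) \<or>
               (\<not> integral n x \<and> U < lp_val n E F \<and> s' = (Op - {F}, U, Suc c)) \<or>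
               (\<not> integral n x \<and> \<not> U < lp_val n E F \<and>
                  (\<exists>j. rule n E F x j \<and>
                     s' = ((Op - {F}) \<union> {F(j := Some False), F(j := Some True)}, U, Suc c)))))"
      using st unfolding bb_step_def s by (auto simp: Let_def)
    have gF: "Good F" using good F by blast
    have z: "lp_val n E F \<le> opt" using le_opt gF by blast
    have split: "(\<Sum>F\<in>Op. 2 * int (W F) - 1)
        = (2 * int (W F) - 1) + (\<Sum>F\<in>Op - {F}. 2 * int (W F) - 1)"
      by (rule sum.remove[OF fin F])
    \<comment> \<open>Infeasibility is ruled out because the LP value is at most the finite
      \<open>opt\<close>.\<close>
    from cases z opt obtain x where x: "solver_ok n E F x" and
      c2: "(integral n x \<and> s' = (Op - {F}, min U (lp_val n E F), Suc c)) \<or>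
           (\<not> integral n x \<and> U < lp_val n E F \<and> s' = (Op - {F}, U, Suc c)) \<or>
           (\<not> integral n x \<and> (\<exists>j. rule n E F x j \<and>
              s' = ((Op - {F}) \<union> {F(j := Some False), F(j := Some True)}, U, Suc c)))"
      by fastforce
    \<comment> \<open>The incumbent never drops below \<open>opt\<close> and no LP value exceeds it,
      so no node is pruned by bound.\<close>
    have "\<not> U < lp_val n E F" using U z by auto
    with c2 consider (int) "integral n x" "s' = (Op - {F}, min U (lp_val n E F), Suc c)"
      | (br) j where "\<not> integral n x" "rule n E F x j"
         "s' = ((Op - {F}) \<union> {F(j := Some False), F(j := Some True)}, U, Suc c)"
      by blast
    then show ?thesis
    proof cases
      case int
      with leaf[OF gF x] have "W F = 1" "lp_val n E F = opt" by auto
      then show ?thesis using int fin good U inc cnt split by (auto simp: I_def)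
    next
      case br
      let ?F0 = "F(j := Some False)" and ?F1 = "F(j := Some True)"
      from branch[OF gF x br(1,2)] have j: "F j = None" and g: "\<And>b. Good (F(j := Some b))"
        and W: "W ?F0 + W ?F1 = W F" by auto
      have i01: "incompat ?F0 ?F1" unfolding incompat_def by (rule exI[of _ j]) auto
      have i10: "incompat ?F1 ?F0" using incompat_sym[OF i01] .
      have iG: "incompat (F(j := Some b)) G" "incompat G (F(j := Some b))"
        if "G \<in> Op - {F}" for G b
      proof -
        have "incompat F G" using inc F that by auto
        then show "incompat (F(j := Some b)) G" using j by (rule incompat_upd)
        then show "incompat G (F(j := Some b))" by (rule incompat_sym)
      qed
      \<comment> \<open>A child is incompatible with every other open node, hence not already open,
        and the union really adds two elements.\<close>
      have new: "F(j := Some b) \<notin> Op - {F}" for b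
        using iG incompat_irrefl by blast
      have ne: "?F0 \<noteq> ?F1" using i01 incompat_irrefl by metis
      have un: "(Op - {F}) \<union> {?F0, ?F1} = insert ?F0 (insert ?F1 (Op - {F}))" by blast
      have "(\<Sum>F\<in>(Op - {F}) \<union> {?F0, ?F1}. 2 * int (W F) - 1)
         = (2 * int (W ?F0) - 1) + ((2 * int (W ?F1) - 1) + (\<Sum>F\<in>Op - {F}. 2 * int (W F) - 1))"
        unfolding un using fin new ne by (subst sum.insert; simp)
      moreover have "\<forall>G\<in>(Op - {F}) \<union> {?F0, ?F1}. \<forall>H\<in>(Op - {F}) \<union> {?F0, ?F1}. G \<noteq> H \<longrightarrow> incompat G H"
        using inc iG i01 i10 by blast
      moreover have "\<forall>G\<in>(Op - {F}) \<union> {?F0, ?F1}. Good G" using good g by blast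
      ultimately show ?thesis
        using fin U cnt split W unfolding I_def br(3) prod.case by auto
    qed
  qed
  obtain U where "(bb_step n E rule)\<^sup>*\<^sup>* ({\<lambda>_. None}, \<infinity>, 0) ({}, U, t)"
    using tree unfolding bb_tree_def by blast
  moreover have "I ({\<lambda>_. None}, \<infinity>, 0)" using root by (simp add: I_def)
  ultimately have "I ({}, U, t)"
    by (induction rule: rtranclp_induct) (use step in auto)
  then show ?thesis by (simp add: I_def)
qed

section \<open>Linear programming relaxation of vertex cover\<close>

lemma lp_val_eqI:
  assumes "y \<in> lp_feas n E F" "obj n y = r" "\<And>x. x \<in> lp_feas n E F \<Longrightarrow> r \<le> obj n x"
  shows "lp_val n E F = ereal r"
  unfolding lp_val_def
proof (rule antisym)
  show "(INF x\<in>lp_feas n E F. ereal (obj n x)) \<le> ereal r"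
    using assms(1,2) by (metis INF_lower)
  show "ereal r \<le> (INF x\<in>lp_feas n E F. ereal (obj n x))"
    by (rule INF_greatest) (simp add: assms(3))
qed

text \<open>The perturbation argument behind the integrality of bipartite vertex cover: shifting the
  fractional coordinates by \<open>\<plusminus>\<epsilon>\<sigma>\<close> stays feasible, because the other end of an edge with
  just one fractional end has value 1.\<close>

lemma extreme_pt_alternating:
  assumes graph: "vc_graph n E"
    and ext: "extreme_pt (lp_feas n E F) x"
    and bounded: "\<And>v. \<bar>\<sigma> v\<bar> \<le> (1::real)"
    and alt: "\<And>u v. {u, v} \<in> E \<Longrightarrow> u \<noteq> v \<Longrightarrow> frac x u \<Longrightarrow> frac x v \<Longrightarrow> \<sigma> u + \<sigma> v = 0"
    and v: "frac x v"
  shows "\<sigma> v = 0"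
proof (rule ccontr)
  assume "\<sigma> v \<noteq> 0"
  have x: "x \<in> lp_feas n E F" using ext by (simp add: extreme_pt_def)
  have zero: "x v = 0" if "n \<le> v" for v using x that by (simp add: lp_feas_def)
  have fn: "w < n" if "frac x w" for w
    using zero[of w] that unfolding frac_def by force
  let ?A = "(\<lambda>w. min (x w) (1 - x w)) ` {w. w < n \<and> frac x w}"
  \<comment> \<open>The smallest distance of a fractional coordinate from 0 and 1, so a shift by at
    most \<open>e\<close> stays in the unit interval.\<close>
  define e where "e = Min ?A"
  have ne: "finite ?A" "?A \<noteq> {}" using v fn by auto
  have "e > 0" unfolding e_def using ne by (subst Min_gr_iff) (auto simp: frac_def)
  have e: "e \<le> x w" "e \<le> 1 - x w" if "frac x w" for w
    using Min_le[OF ne(1), of "min (x w) (1 - x w)"] fn that unfolding e_def by fastforce+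
  define d where "d = (\<lambda>w. if frac x w then e * \<sigma> w else 0)"
  have d: "\<bar>d w\<bar> \<le> e" if "frac x w" for w
    using mult_left_mono[OF bounded[of w], of e] \<open>e > 0\<close> that by (simp add: d_def abs_mult)
  have d0: "d w = 0" if "\<not> frac x w" for w using that by (simp add: d_def)
  have feas: "(\<lambda>w. x w + s * d w) \<in> lp_feas n E F" if s: "s = 1 \<or> s = -1" for s :: real
  proof -
    have sd: "\<bar>s * d w\<bar> \<le> e" if "frac x w" for w using d[OF that] s by (auto simp: abs_mult)
    have "0 \<le> x w + s * d w \<and> x w + s * d w \<le> 1" if "w < n" for w
    proof (cases "frac x w")
      case True
      then show ?thesis using sd[OF True] e[OF True] by linarith
    next
      case False
      then show ?thesis using x that by (simp add: d0 lp_feas_def)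
    qed
    moreover have "x u + s * d u + (x w + s * d w) \<ge> 1"
      if "g \<in> E" "u \<in> g" "w \<in> g" "u \<noteq> w" for g u w
    proof -
      have "card g = 2" and sub: "g \<subseteq> {..<n}" using graph that by (auto simp: vc_graph_def)
      then have "g = {u, w}" using that by (auto simp: card_2_iff)
      have g1: "x u + x w \<ge> 1" using x that unfolding lp_feas_def by blast
      have bd: "0 \<le> x u" "x u \<le> 1" "0 \<le> x w" "x w \<le> 1"
        using x sub that by (auto simp: lp_feas_def)
      consider "frac x u" "frac x w" | "frac x u" "\<not> frac x w" | "\<not> frac x u" "frac x w"
        | "\<not> frac x u" "\<not> frac x w" by blast
      then show ?thesis
      proof cases
        case 1
        then have "\<sigma> u + \<sigma> w = 0" using alt \<open>g = {u, w}\<close> that by blast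
        then have "d u + d w = 0" using 1 by (simp add: d_def flip: distrib_left)
        then have "s * d u + s * d w = 0" by (simp flip: distrib_left)
        then show ?thesis using g1 by linarith
      next
        case 2
        then have "x w = 1" using g1 bd unfolding frac_def by linarith
        then show ?thesis using d0[OF 2(2)] sd[OF 2(1)] e[OF 2(1)] by simp
      next
        case 3
        then have "x u = 1" using g1 bd unfolding frac_def by linarith
        then show ?thesis using d0[OF 3(1)] sd[OF 3(2)] e[OF 3(2)] by simp
      next
        case 4
        then show ?thesis using d0 g1 by simp
      qed
    qed
    moreover have "F w = Some b \<Longrightarrow> w < n \<Longrightarrow> d w = 0" for w b
      using x by (cases b) (auto intro!: d0 simp: frac_def lp_feas_def)
    moreover have "d w = 0" if "n \<le> w" for w using fn[of w] d0[of w] that by auto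
    ultimately show ?thesis using x unfolding lp_feas_def by auto
  qed
  have "(\<lambda>w. x w + 1 * d w) \<noteq> (\<lambda>w. x w + (-1) * d w)"
  proof
    assume "(\<lambda>w. x w + 1 * d w) = (\<lambda>w. x w + (-1) * d w)"
    then have "x v + 1 * d v = x v + (-1) * d v" by meson
    then show False using v \<open>\<sigma> v \<noteq> 0\<close> \<open>e > 0\<close> by (simp add: d_def)
  qed
  moreover have "x = (\<lambda>w. (1/2) * (x w + 1 * d w) + (1 - 1/2) * (x w + (-1) * d w))"
    by (auto simp: field_simps)
  moreover have "(0::real) < 1/2" "(1/2::real) < 1" by auto
  ultimately show False
    using ext feas[of 1] feas[of "-1"] unfolding extreme_pt_def by blast
qed

section \<open>The gadget\<close>

text \<open>Vertices 0, 1, 2 form a triangle. The hub 3 has the larger degree 4: it is joined to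
  the triangle vertex 0, to the pendant vertex 4, and to the edges 56 and 78.\<close>

definition gadget :: "(nat \<times> nat) set" where
  "gadget = {(0,1), (0,2), (1,2), (0,3), (3,4), (3,5), (5,6), (3,7), (7,8)}"

definition lfeas :: "fixing \<Rightarrow> (nat \<Rightarrow> real) \<Rightarrow> bool" where
  "lfeas f y \<longleftrightarrow> (\<forall>t<9. 0 \<le> y t \<and> y t \<le> 1 \<and> (f t = Some False \<longrightarrow> y t = 0) \<and> (f t = Some True \<longrightarrow> y t = 1))
     \<and> (\<forall>(s,t)\<in>gadget. y s + y t \<ge> 1)"

definition untouched :: "fixing \<Rightarrow> bool" where
  "untouched f \<longleftrightarrow> (\<forall>t<9. f t = None)"

definition hub_only :: "fixing \<Rightarrow> bool" where
  "hub_only f \<longleftrightarrow> f 3 = Some True \<and> (\<forall>t<9. t \<noteq> 3 \<longrightarrow> f t = None)"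

text \<open>Either the hub alone is fixed, to 0, or exactly one triangle vertex is fixed. In the
  second case the hub may be free, as under strong branching, or fixed to 1, as under the greedy
  rule.\<close>

definition resolved :: "fixing \<Rightarrow> bool" where
  "resolved f \<longleftrightarrow> (f 3 = Some False \<and> (\<forall>t<9. t \<noteq> 3 \<longrightarrow> f t = None)) \<or>
     (f 3 \<noteq> Some False \<and> (\<exists>z<3. f z \<noteq> None \<and> (\<forall>t<9. t \<noteq> z \<longrightarrow> t \<noteq> 3 \<longrightarrow> f t = None)))"

text \<open>The vertices of a copy that every solver answer makes fractional at a
  \<open>typed\<close> state; see \<open>solver_frac\<close>.\<close>

definition lfrac :: "fixing \<Rightarrow> nat set" where
  "lfrac f = (if untouched f then {..<9} else if hub_only f then {..<3} else {})"

definition lcost :: "fixing \<Rightarrow> real" where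
  "lcost f = (if resolved f then 5 else 9/2)"

definition typed :: "fixing \<Rightarrow> bool" where
  "typed f \<longleftrightarrow> untouched f \<or> hub_only f \<or> resolved f"

lemma all_less_9: "(\<forall>t<9. P t) \<longleftrightarrow> P 0 \<and> P 1 \<and> P 2 \<and> P 3 \<and> P 4 \<and> P 5 \<and> P 6 \<and> P 7 \<and> P (8::nat)"
  by (simp only: eval_nat_numeral BitM.simps All_less_Suc One_nat_def) (simp, blast)

lemma ex_less_3: "(\<exists>t<3. P t) \<longleftrightarrow> P 0 \<or> P 1 \<or> P (2::nat)"
  by (simp only: eval_nat_numeral BitM.simps Ex_less_Suc One_nat_def) auto

lemma sum_less_9: "(\<Sum>t<9. y t) = y 0 + y 1 + y 2 + y 3 + y 4 + y 5 + y 6 + y 7 + (y (8::nat) :: real)"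
  by (simp add: eval_nat_numeral)

lemma resolved_not: "resolved f \<Longrightarrow> \<not> untouched f" "resolved f \<Longrightarrow> \<not> hub_only f"
  "hub_only f \<Longrightarrow> \<not> untouched f"
  unfolding resolved_def untouched_def hub_only_def by (auto simp: all_less_9 ex_less_3)

lemmas local_defs = lfeas_def gadget_def all_less_9 ex_less_3 sum_less_9

text \<open>The triangle costs at least 3/2, by adding its three edges, and the matching 34, 56, 78
  costs at least 3.\<close>

lemma lfeas_sum_ge: "lfeas f y \<Longrightarrow> 9/2 \<le> (\<Sum>t<9. y t)"
  by (simp add: local_defs)

lemma resolved_cases:
  assumes "resolved f"
  obtains "f 3 = Some False" "\<forall>t<9. t \<noteq> 3 \<longrightarrow> f t = None"
  | z b where "z < 3" "f z = Some b" "f 3 \<noteq> Some False" "\<forall>t<9. t \<noteq> z \<longrightarrow> t \<noteq> 3 \<longrightarrow> f t = None"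
  using assms unfolding resolved_def by fastforce

text \<open>Hub at 0 forces 0, 4, 5, 7 to 1, and the edge 12 costs one more. A triangle vertex at
  either value makes the triangle cost 2, and the matching 34, 56, 78 costs 3.\<close>

lemma lfeas_resolved_sum_ge:
  assumes "lfeas f y" "resolved f" shows "5 \<le> (\<Sum>t<9. y t)"
  using assms(2)
proof (cases rule: resolved_cases)
  case 1
  then show ?thesis using assms(1) by (simp add: local_defs)
next
  case (2 z b)
  then have "z = 0 \<or> z = 1 \<or> z = 2" by auto
  then show ?thesis using 2(2) assms(1) by (elim disjE; cases b) (simp_all add: local_defs)
qed

lemma lcost_le_sum: "lfeas f y \<Longrightarrow> lcost f \<le> (\<Sum>t<9. y t)"
  using lfeas_sum_ge lfeas_resolved_sum_ge unfolding lcost_def by auto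

text \<open>Local counterpart of extremality, with points compared on the nine vertices
  only.\<close>

definition lrigid :: "fixing \<Rightarrow> (nat \<Rightarrow> real) \<Rightarrow> bool" where
  "lrigid f y \<longleftrightarrow> (\<forall>u w \<tau>. lfeas f u \<longrightarrow> lfeas f w \<longrightarrow> 0 < \<tau> \<longrightarrow> \<tau> < 1 \<longrightarrow>
     (\<forall>t<9. y t = \<tau> * u t + (1 - \<tau>) * w t) \<longrightarrow> (\<forall>t<9. u t = w t))"

lemma convex_comb_eq_bound:
  fixes u w :: real
  assumes "a \<le> u" "a \<le> w" "0 < \<tau>" "\<tau> < 1" "\<tau> * u + (1 - \<tau>) * w = a"
  shows "u = a" "w = a"
proof -
  have "\<tau> * (u - a) + (1 - \<tau>) * (w - a) = 0" using assms(5) by (simp add: algebra_simps)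
  moreover have "0 \<le> \<tau> * (u - a)" "0 \<le> (1 - \<tau>) * (w - a)" using assms by auto
  ultimately have "\<tau> * (u - a) = 0 \<and> (1 - \<tau>) * (w - a) = 0" by linarith
  then show "u = a" "w = a" using assms by auto
qed

lemma convex_comb_binary:
  fixes u w :: real
  assumes "0 \<le> u" "u \<le> 1" "0 \<le> w" "w \<le> 1" "0 < \<tau>" "\<tau> < 1"
    "\<tau> * u + (1 - \<tau>) * w = 0 \<or> \<tau> * u + (1 - \<tau>) * w = 1"
  shows "u = w"
  using assms(7)
proof
  assume "\<tau> * u + (1 - \<tau>) * w = 0"
  then show ?thesis using convex_comb_eq_bound[of 0 u w \<tau>] assms by auto
next
  assume "\<tau> * u + (1 - \<tau>) * w = 1"
  \<comment> \<open>Negation turns the upper bound 1 into a lower bound.\<close>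
  then have "\<tau> * (- u) + (1 - \<tau>) * (- w) = - 1" by simp
  then show ?thesis using convex_comb_eq_bound[of "-1" "-u" "-w" \<tau>] assms by auto
qed

text \<open>In a convex decomposition both points inherit every tight edge and every coordinate at 0
  or 1. It remains that the tight edges in \<open>S\<close> determine the coordinates in
  \<open>T\<close>.\<close>

lemma lrigid_tight:
  assumes "\<And>s t. (s, t) \<in> S \<Longrightarrow> (s, t) \<in> gadget \<and> y s + y t = 1"
    and "\<And>t. t < 9 \<Longrightarrow> t \<notin> T \<Longrightarrow> y t = 0 \<or> y t = 1"
    and "\<And>u w :: nat \<Rightarrow> real. (\<And>s t. (s, t) \<in> S \<Longrightarrow> u s + u t = 1 \<and> w s + w t = 1) \<Longrightarrow>
       \<forall>t\<in>T. u t = w t"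
  shows "lrigid f y"
  unfolding lrigid_def
proof (intro allI impI)
  fix u w and \<tau> :: real and t :: nat
  assume uw: "lfeas f u" "lfeas f w" and \<tau>: "0 < \<tau>" "\<tau> < 1"
    and y: "\<forall>t<9. y t = \<tau> * u t + (1 - \<tau>) * w t" and t: "t < 9"
  have "u a + u b = 1 \<and> w a + w b = 1" if "(a, b) \<in> S" for a b
  proof -
    have ab: "(a, b) \<in> gadget" "y a + y b = 1" using assms(1) that by auto
    then have "a < 9" "b < 9" by (auto simp: gadget_def)
    then have "\<tau> * (u a + u b) + (1 - \<tau>) * (w a + w b) = 1"
      using ab(2) y by (simp add: algebra_simps)
    moreover have "1 \<le> u a + u b" "1 \<le> w a + w b" using uw ab(1) by (auto simp: lfeas_def)
    ultimately show ?thesis using convex_comb_eq_bound[of 1 "u a + u b" "w a + w b" \<tau>] \<tau> by auto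
  qed
  then have T: "\<forall>t\<in>T. u t = w t" using assms(3) by blast
  show "u t = w t"
  proof (cases "t \<in> T")
    case False
    then have "y t = 0 \<or> y t = 1" using assms(2) t by blast
    then show ?thesis using y t uw \<tau> by (intro convex_comb_binary[of _ _ \<tau>]) (auto simp: lfeas_def)
  qed (use T in blast)
qed

text \<open>An optimal extreme point of one copy that has the predicted fractional set.\<close>

definition witness :: "fixing \<Rightarrow> (nat \<Rightarrow> real) \<Rightarrow> bool" where
  "witness f y \<longleftrightarrow> lfeas f y \<and> (\<Sum>t<9. y t) = lcost f \<and> {t. t < 9 \<and> frac y t} = lfrac f \<and> lrigid f y"

lemma witness_integralI:
  assumes "resolved f" "lfeas f y" "(\<Sum>t<9. y t) = 5" "\<forall>t<9. y t = 0 \<or> y t = 1"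
  shows "witness f y"
proof -
  have "lrigid f y" by (rule lrigid_tight[of "{}" _ "{}"]) (use assms in auto)
  moreover have "{t. t < 9 \<and> frac y t} = {}" using assms(4) by (auto simp: frac_def)
  ultimately show ?thesis using assms resolved_not by (auto simp: witness_def lcost_def lfrac_def)
qed

lemma witness_exists:
  assumes "typed f" shows "\<exists>y. witness f y"
proof -
  from assms consider (u) "untouched f" | (h) "hub_only f" | (r) "resolved f"
    unfolding typed_def by blast
  then show ?thesis
  proof cases
    case u
    let ?y = "\<lambda>t::nat. 1/2 :: real"
    have "lrigid f ?y"
    \<comment> \<open>All edges are tight: the odd cycle forces 1/2 on the triangle, and the value
      spreads along the connected gadget.\<close>
    proof (rule lrigid_tight[of gadget _ "{..<9}"])
      fix u w :: "nat \<Rightarrow> real"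
      assume *: "\<And>s t. (s, t) \<in> gadget \<Longrightarrow> u s + u t = 1 \<and> w s + w t = 1"
      have "\<forall>(s,t)\<in>gadget. u s + u t = 1 \<and> w s + w t = 1" using * by auto
      then have "\<forall>t<9. u t = w t" by (simp add: gadget_def all_less_9)
      then show "\<forall>t\<in>{..<9}. u t = w t" by simp
    qed auto
    moreover have "lfeas f ?y" using u by (auto simp: lfeas_def untouched_def)
    moreover have "\<not> resolved f" using u resolved_not by blast
    ultimately have "witness f ?y" using u by (auto simp: witness_def lcost_def lfrac_def frac_def)
    then show ?thesis by blast
  next
    case h
    \<comment> \<open>Vertices 3, 5, 7 cover all edges outside the triangle, which stays at
      1/2.\<close>
    let ?y = "\<lambda>t::nat. if t < 3 then 1/2 else if t \<in> {3, 5, 7} then 1 else 0 :: real"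
    have "lrigid f ?y"
    proof (rule lrigid_tight[of "{(0,1), (0,2), (1,2)}" _ "{..<3}"])
      fix u w :: "nat \<Rightarrow> real"
      assume *: "\<And>s t. (s, t) \<in> {(0,1), (0,2), (1,2)} \<Longrightarrow> u s + u t = 1 \<and> w s + w t = 1"
      have "\<forall>(s,t)\<in>{(0,1), (0,2), (1,2)}. u s + u t = 1 \<and> w s + w t = 1" using * by auto
      then have "u 0 = w 0" "u 1 = w 1" "u 2 = w 2" by auto
      then show "\<forall>t\<in>{..<3}. u t = w t" by (auto simp: numeral_eq_Suc less_Suc_eq)
    qed (auto simp: gadget_def)
    moreover have "lfeas f ?y" using h by (auto simp: local_defs hub_only_def)
    moreover have "\<not> resolved f" "\<not> untouched f" using h resolved_not by blast+
    moreover have "{t. t < 9 \<and> frac ?y t} = {..<3}" by (auto simp: frac_def split: if_splits)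
    moreover have "(\<Sum>t<9. ?y t) = 9/2" by (simp add: sum_less_9)
    ultimately have "witness f ?y" using h by (simp add: witness_def lcost_def lfrac_def)
    then show ?thesis by blast
  next
    case r
    then show ?thesis
    proof (cases rule: resolved_cases)
      case 1
      \<comment> \<open>Hub at 0 forces 0, 4, 5, 7 into the cover, and 1 covers the edge 12.\<close>
      have "witness f (\<lambda>t. if t \<in> {0, 1, 4, 5, 7} then 1 else 0)"
        using r 1 by (intro witness_integralI) (auto simp: local_defs)
      then show ?thesis by blast
    next
      case (2 z b)
      \<comment> \<open>Outside the triangle the cover is 3, 5, 7. Inside it consists of two
        vertices, \<open>z\<close> among them exactly if \<open>b\<close> holds.\<close>
      let ?y = "\<lambda>t. if t \<in> {3, 5, 7} \<or> (if b then t = z \<or> t = (if z = 0 then 1 else 0) else t < 3 \<and> t \<noteq> z)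
        then 1 else 0 :: real"
      have z: "z = 0 \<or> z = 1 \<or> z = 2" using 2 by auto
      have "lfeas f ?y" using z 2 by (elim disjE; cases b) (simp_all add: local_defs)
      moreover have "(\<Sum>t<9. ?y t) = 5" using z by (elim disjE; cases b) (simp_all add: sum_less_9)
      ultimately have "witness f ?y" using r by (intro witness_integralI) auto
      then show ?thesis by blast
    qed
  qed
qed

text \<open>Some child of a non-triangle vertex does not change the LP value, so its product score is 0.\<close>

lemma free_child:
  assumes "untouched f" "3 \<le> t" "t < 9"
  shows "\<exists>b y. lfeas (f(t := Some b)) y \<and> (\<Sum>t<9. y t) = 9/2"
proof -
  let ?y = "\<lambda>t::nat. if t < 3 then 1/2 else if t \<in> {3, 5, 7} then 1 else 0 :: real"
  \<comment> \<open>Each vertex outside the triangle is fixed to the value that it already has in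
    this point.\<close>
  have "lfeas (f(t := Some (t \<in> {3, 5, 7}))) ?y"
    using assms by (auto simp: lfeas_def untouched_def gadget_def)
  moreover have "(\<Sum>t<9. ?y t) = 9/2" by (simp add: sum_less_9)
  ultimately show ?thesis by blast
qed

lemma upd_hub_untouched:
  assumes "untouched f"
  shows "hub_only (f(3 := Some True))" "resolved (f(3 := Some False))"
  using assms by (auto simp: untouched_def hub_only_def resolved_def)

lemma upd_triangle:
  assumes "untouched f \<or> hub_only f" "t < 3"
  shows "resolved (f(t := Some b))"
proof -
  have "f 3 \<noteq> Some False" "\<forall>s<9. s \<noteq> 3 \<longrightarrow> f s = None"
    using assms by (auto simp: untouched_def hub_only_def)
  then show ?thesis using assms(2) unfolding resolved_def by (intro disjI2 conjI exI[of _ t]) auto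
qed

section \<open>Disjoint copies of the gadget\<close>

definition copies :: "nat \<Rightarrow> nat set set" where
  "copies m = {{i * 9 + s, i * 9 + t} | i s t. i < m \<and> (s, t) \<in> gadget}"

text \<open>Truncation with \<open>undefined\<close> makes \<open>loc g i\<close> independent of the
  other copies, so \<open>loc_upd\<close> holds as an equation of functions.\<close>

definition loc :: "(nat \<Rightarrow> 'a) \<Rightarrow> nat \<Rightarrow> nat \<Rightarrow> 'a" where
  "loc g i = (\<lambda>t. if t < 9 then g (i * 9 + t) else undefined)"

lemma gadget_less: "(s, t) \<in> gadget \<Longrightarrow> s < t \<and> t < 9"
  by (auto simp: gadget_def)

lemma loc_upd:
  assumes "t < 9"
  shows "loc (F(i * 9 + t := b)) i' = (if i' = i then (loc F i)(t := b) else loc F i')"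
proof -
  have "i' = i \<and> s = t" if "i' * 9 + s = i * 9 + t" "s < 9" for s
    using arg_cong[OF that(1), of "\<lambda>v. v div 9"] arg_cong[OF that(1), of "\<lambda>v. v mod 9"] that(2) assms
    by simp
  then have "i' * 9 + s = i * 9 + t \<longleftrightarrow> i' = i \<and> s = t" if "s < 9" for s
    using that by blast
  then show ?thesis using assms by (simp add: loc_def fun_eq_iff)
qed

lemma vertex_cases:
  fixes v m :: nat
  assumes "v < m * 9"
  obtains i t where "v = i * 9 + t" "i < m" "t < 9"
  using that[of "v div 9" "v mod 9"] assms by auto

lemma vertex_less: "i < m \<Longrightarrow> t < 9 \<Longrightarrow> i * 9 + t < m * (9::nat)"
  by linarith

lemma vc_graph_copies: "vc_graph (m * 9) (copies m)"
proof -
  have "card {i * 9 + s, i * 9 + t} = 2 \<and> {i * 9 + s, i * 9 + t} \<subseteq> {..<m * 9}"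
    if "i < m" "(s, t) \<in> gadget" for i s t
    using gadget_less[OF that(2)] vertex_less[OF that(1)] by auto
  then show ?thesis unfolding vc_graph_def copies_def by blast
qed

text \<open>No edge joins two copies, so the LP polytope is the product of the local ones.\<close>

lemma lp_feas_copies:
  "x \<in> lp_feas (m * 9) (copies m) F \<longleftrightarrow>
     (\<forall>v. m * 9 \<le> v \<longrightarrow> x v = 0) \<and> (\<forall>i<m. lfeas (loc F i) (loc x i))" (is "?L \<longleftrightarrow> ?R")
proof
  assume x: ?L
  have "lfeas (loc F i) (loc x i)" if "i < m" for i
  proof -
    have edge: "loc x i s + loc x i t \<ge> 1" if st: "(s, t) \<in> gadget" for s t
    proof -
      have "{i * 9 + s, i * 9 + t} \<in> copies m" using st \<open>i < m\<close> unfolding copies_def by blast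
      moreover have "i * 9 + s \<noteq> i * 9 + t" using gadget_less[OF st] by auto
      ultimately have "x (i * 9 + s) + x (i * 9 + t) \<ge> 1" using x unfolding lp_feas_def by blast
      then show ?thesis using gadget_less[OF st] by (simp add: loc_def)
    qed
    have "\<forall>(s, t)\<in>gadget. loc x i s + loc x i t \<ge> 1" using edge by blast
    moreover have "\<forall>t<9. i * 9 + t < m * 9" using vertex_less[OF \<open>i < m\<close>] by blast
    ultimately show ?thesis using x unfolding lfeas_def lp_feas_def by (simp add: loc_def)
  qed
  then show ?R using x by (simp add: lp_feas_def)
next
  assume x: ?R
  have v: "0 \<le> x v \<and> x v \<le> 1 \<and> (F v = Some False \<longrightarrow> x v = 0) \<and> (F v = Some True \<longrightarrow> x v = 1)"
    if "v < m * 9" for v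
  proof -
    obtain i t where it: "v = i * 9 + t" "i < m" "t < 9" using \<open>v < m * 9\<close> by (rule vertex_cases)
    then have "lfeas (loc F i) (loc x i)" using x by blast
    then show ?thesis using it by (simp add: lfeas_def loc_def)
  qed
  have "x u + x v \<ge> 1" if e: "e \<in> copies m" "u \<in> e" "v \<in> e" "u \<noteq> v" for e u v
  proof -
    obtain i s t where i: "i < m" and st: "(s, t) \<in> gadget" and e': "e = {i * 9 + s, i * 9 + t}"
      using e(1) unfolding copies_def by blast
    have "x (i * 9 + s) + x (i * 9 + t) \<ge> 1"
    proof -
      have "loc x i s + loc x i t \<ge> 1" using x i st unfolding lfeas_def by blast
      then show ?thesis using gadget_less[OF st] by (simp add: loc_def)
    qed
    then show ?thesis using e e' by auto
  qed
  then show ?L using x v unfolding lp_feas_def by auto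
qed

lemma obj_copies: "obj (m * 9) x = (\<Sum>i<m. \<Sum>t<9. loc x i t)"
proof -
  have "(\<Sum>i<m. \<Sum>t<9. loc x i t) = (\<Sum>i<m. sum x {i * 9..<i * 9 + 9})"
  proof (rule sum.cong)
    fix i
    show "(\<Sum>t<9. loc x i t) = sum x {i * 9..<i * 9 + 9}"
      using sum.shift_bounds_nat_ivl[of x 0 "i * 9" 9]
      by (simp add: loc_def lessThan_atLeast0 add.commute)
  qed simp
  then show ?thesis by (simp add: obj_def sum.nat_group)
qed

text \<open>Assembles local points into a global one; the default 0 is what \<open>lp_feas\<close>
  demands beyond the last vertex.\<close>

definition glue :: "nat \<Rightarrow> (nat \<Rightarrow> nat \<Rightarrow> real) \<Rightarrow> nat \<Rightarrow> real" where
  "glue m Y v = (if v < m * 9 then Y (v div 9) (v mod 9) else 0)"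

lemma glue_vertex: "i < m \<Longrightarrow> t < 9 \<Longrightarrow> glue m Y (i * 9 + t) = Y i t"
  using vertex_less[of i m t] by (simp add: glue_def)

lemma loc_glue: "i < m \<Longrightarrow> t < 9 \<Longrightarrow> loc (glue m Y) i t = Y i t"
  by (simp add: loc_def glue_vertex)

lemma lfeas_cong:
  assumes "\<And>t. t < 9 \<Longrightarrow> y t = y' t" shows "lfeas f y \<longleftrightarrow> lfeas f y'"
proof -
  have "y s + y t = y' s + y' t" if "(s, t) \<in> gadget" for s t
    using gadget_less[OF that] assms by simp
  then show ?thesis unfolding lfeas_def using assms by auto
qed

lemma glue_feas:
  assumes "\<And>i. i < m \<Longrightarrow> lfeas (loc F i) (Y i)"
  shows "glue m Y \<in> lp_feas (m * 9) (copies m) F"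
proof -
  have "lfeas (loc F i) (loc (glue m Y) i)" if "i < m" for i
    using assms[OF that] lfeas_cong[of "loc (glue m Y) i" "Y i"] loc_glue[OF that] by blast
  then show ?thesis by (simp add: lp_feas_copies glue_def)
qed

lemma glue_obj: "obj (m * 9) (glue m Y) = (\<Sum>i<m. \<Sum>t<9. Y i t)"
  by (simp add: obj_copies loc_glue)

lemma lp_val_copies:
  assumes "\<And>i. i < m \<Longrightarrow> lfeas (loc F i) (Y i)"
    and "\<And>i. i < m \<Longrightarrow> (\<Sum>t<9. Y i t) = c i"
    and "\<And>i y. i < m \<Longrightarrow> lfeas (loc F i) y \<Longrightarrow> c i \<le> (\<Sum>t<9. y t)"
  shows "lp_val (m * 9) (copies m) F = ereal (\<Sum>i<m. c i)"
proof (rule lp_val_eqI)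
  show "glue m Y \<in> lp_feas (m * 9) (copies m) F" using assms(1) by (rule glue_feas)
  show "obj (m * 9) (glue m Y) = (\<Sum>i<m. c i)" by (simp add: glue_obj assms(2))
  show "(\<Sum>i<m. c i) \<le> obj (m * 9) x" if "x \<in> lp_feas (m * 9) (copies m) F" for x
    unfolding obj_copies using that by (intro sum_mono assms(3)) (auto simp: lp_feas_copies)
qed

section \<open>Solver answers at nodes whose copies are all in a known state\<close>

definition good :: "nat \<Rightarrow> fixing \<Rightarrow> bool" where
  "good m F \<longleftrightarrow> (\<forall>i<m. typed (loc F i))"

lemma good_upd:
  assumes "good m F" "t < 9" "typed ((loc F i)(t := b))"
  shows "good m (F(i * 9 + t := b))"
  using assms by (auto simp: good_def loc_upd)

lemma good_witness:
  assumes "good m F"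
  obtains Y where "\<forall>i<m. witness (loc F i) (Y i)"
proof -
  have "\<forall>i. \<exists>y. i < m \<longrightarrow> witness (loc F i) y"
    using assms witness_exists unfolding good_def by blast
  from choice[OF this] obtain Y where "\<forall>i. i < m \<longrightarrow> witness (loc F i) (Y i)" ..
  then show ?thesis using that by blast
qed

lemma lp_val_good:
  assumes "good m F"
  shows "lp_val (m * 9) (copies m) F = ereal (\<Sum>i<m. lcost (loc F i))"
proof -
  obtain Y where "\<forall>i<m. witness (loc F i) (Y i)" using good_witness[OF assms] .
  then show ?thesis by (intro lp_val_copies[of _ _ Y] lcost_le_sum) (auto simp: witness_def)
qed

text \<open>The fractional vertices outside the predicted set would span a bipartite graph, whose
  alternating signs contradict extremality by \<open>extreme_pt_alternating\<close>.\<close>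

lemma extreme_frac_subset:
  assumes good: "good m F" and ext: "extreme_pt (lp_feas (m * 9) (copies m) F) x"
    and i: "i < m" and t: "t < 9" and fr: "frac x (i * 9 + t)"
  shows "t \<in> lfrac (loc F i)"
proof (rule ccontr)
  assume not: "t \<notin> lfrac (loc F i)"
  let ?f = "loc F i" and ?y = "loc x i"
  have y: "lfeas ?f ?y" using ext i by (auto simp: extreme_pt_def lp_feas_copies)
  have fixed: "\<not> frac x (i * 9 + s)" if "s < 9" "?f s = Some b" for s b
    using y that by (cases b) (auto simp: lfeas_def loc_def frac_def)
  have "\<exists>\<sigma>::nat \<Rightarrow> real. (\<forall>s. \<bar>\<sigma> s\<bar> \<le> 1) \<and> \<sigma> t \<noteq> 0 \<and>
     (\<forall>(s, s')\<in>gadget. frac x (i * 9 + s) \<longrightarrow> frac x (i * 9 + s') \<longrightarrow> \<sigma> s + \<sigma> s' = 0)"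
  proof -
    have "hub_only ?f \<or> resolved ?f"
      using not good i t by (auto simp: good_def typed_def lfrac_def split: if_splits)
    then show ?thesis
    proof
      assume h: "hub_only ?f"
      then have "3 \<le> t" using not resolved_not by (auto simp: lfrac_def)
      moreover have "\<not> frac x (i * 9 + 3)" using fixed[of 3 True] h by (simp add: hub_only_def)
      ultimately show ?thesis
        \<comment> \<open>The fixed hub separates the triangle from the rest, which is a tree and
          gets its two-colouring.\<close>
        by (intro exI[of _ "\<lambda>s. if s < 3 then 0 else if s \<in> {3, 6, 8} then 1 else -1"])
           (auto simp: gadget_def)
    next
      assume r: "resolved ?f"
      \<comment> \<open>If the hub is 0, its edge to vertex 0 forces that vertex to 1.\<close>
      have "\<exists>z<3. \<not> frac x (i * 9 + z)"
        using r
      proof (cases rule: resolved_cases)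
        case 1
        then have "?y 3 = 0" "?y 0 + ?y 3 \<ge> 1" "?y 0 \<le> 1" using y by (auto simp: lfeas_def gadget_def)
        then have "\<not> frac x (i * 9 + 0)" by (simp add: loc_def frac_def)
        then show ?thesis by (intro exI[of _ 0]) simp
      next
        case (2 z b)
        then show ?thesis using fixed[of z b] by auto
      qed
      then obtain z where z: "z < 3" "\<not> frac x (i * 9 + z)" by blast
      then have "z = 0 \<or> z = 1 \<or> z = 2" by auto
      then show ?thesis
        \<comment> \<open>Without the integral vertex \<open>z\<close> the gadget is bipartite. The
          sign of 2 changes for \<open>z = 0\<close>, where 1 and 2 must differ.\<close>
        using z(2) by (intro exI[of _ "\<lambda>s. if s \<in> {0, 4, 5, 7} \<or> (z = 0 \<and> s = 2) then -1 else 1"])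
           (auto simp: gadget_def)
    qed
  qed
  then obtain \<sigma> :: "nat \<Rightarrow> real" where \<sigma>: "\<And>s. \<bar>\<sigma> s\<bar> \<le> 1" "\<sigma> t \<noteq> 0"
    "\<And>s s'. (s, s') \<in> gadget \<Longrightarrow> frac x (i * 9 + s) \<Longrightarrow> frac x (i * 9 + s') \<Longrightarrow> \<sigma> s + \<sigma> s' = 0"
    by blast
  \<comment> \<open>Extension by 0 still alternates, since edges stay within one copy.\<close>
  define \<rho> where "\<rho> v = (if v div 9 = i then \<sigma> (v mod 9) else 0)" for v
  have "\<rho> (i * 9 + t) = 0"
  proof (rule extreme_pt_alternating[OF vc_graph_copies ext _ _ fr])
    show "\<bar>\<rho> v\<bar> \<le> 1" for v using \<sigma>(1) by (simp add: \<rho>_def)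
    show "\<rho> u + \<rho> v = 0" if uv: "{u, v} \<in> copies m" "u \<noteq> v" "frac x u" "frac x v" for u v
    proof -
      obtain k s s' where st: "(s, s') \<in> gadget" and e: "{u, v} = {k * 9 + s, k * 9 + s'}"
        using uv(1) unfolding copies_def by blast
      have "\<rho> (k * 9 + s) + \<rho> (k * 9 + s') = 0"
        using \<sigma>(3)[OF st] gadget_less[OF st] uv e by (auto simp: \<rho>_def doubleton_eq_iff)
      then show ?thesis using e by (auto simp: doubleton_eq_iff)
    qed
  qed
  then show False using \<sigma>(2) t by (simp add: \<rho>_def)
qed

text \<open>A convex decomposition restricts to each copy, where rigidity makes it trivial.\<close>

lemma glue_extreme:
  assumes Y: "\<And>i. i < m \<Longrightarrow> witness (loc F i) (Y i)"
  shows "extreme_pt (lp_feas (m * 9) (copies m) F) (glue m Y)"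
proof -
  have "u = w" if uw: "u \<in> lp_feas (m * 9) (copies m) F" "w \<in> lp_feas (m * 9) (copies m) F"
    and \<tau>: "0 < \<tau>" "\<tau> < 1" and eq: "glue m Y = (\<lambda>v. \<tau> * u v + (1 - \<tau>) * w v)" for u w \<tau>
  proof
    fix v
    show "u v = w v"
    proof (cases "v < m * 9")
      case True
      then obtain i t where v: "v = i * 9 + t" "i < m" "t < 9" by (rule vertex_cases)
      have "\<forall>t<9. Y i t = \<tau> * loc u i t + (1 - \<tau>) * loc w i t"
        using glue_vertex[OF v(2), of _ Y] eq by (simp add: loc_def)
      then have "\<forall>t<9. loc u i t = loc w i t"
        using Y[OF v(2)] uw \<tau> v(2) unfolding witness_def lrigid_def lp_feas_copies by blast
      then show ?thesis using v by (simp add: loc_def)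
    next
      case False
      then show ?thesis using uw by (simp add: lp_feas_copies)
    qed
  qed
  then show ?thesis using glue_feas Y unfolding extreme_pt_def witness_def by blast
qed

text \<open>\<open>extreme_frac_subset\<close> bounds the fractional set from above and the glued
  witnesses attain the bound, so a solver maximizing the number of fractional components has no
  other choice.\<close>

lemma solver_frac:
  assumes good: "good m F" and x: "solver_ok (m * 9) (copies m) F x"
    and i: "i < m" and t: "t < 9"
  shows "frac x (i * 9 + t) \<longleftrightarrow> t \<in> lfrac (loc F i)"
proof -
  obtain Y where "\<forall>i<m. witness (loc F i) (Y i)" using good_witness[OF good] .
  then have Y: "\<And>i. i < m \<Longrightarrow> witness (loc F i) (Y i)" by blast
  let ?n = "m * 9" and ?y = "glue m Y"
  have fy: "?y \<in> lp_feas ?n (copies m) F" using Y by (intro glue_feas) (auto simp: witness_def)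
  have oy: "obj ?n ?y = (\<Sum>i<m. lcost (loc F i))"
    unfolding glue_obj using Y by (intro sum.cong) (auto simp: witness_def)
  have "obj ?n ?y \<le> obj ?n z" if "z \<in> lp_feas ?n (copies m) F" for z
    unfolding oy unfolding obj_copies using that
    by (intro sum_mono lcost_le_sum) (auto simp: lp_feas_copies)
  then have "nfrac ?n ?y \<le> nfrac ?n x"
    using x fy glue_extreme[OF Y] by (auto simp: solver_ok_def lp_optimal_def)
  moreover have sub: "{v. v < ?n \<and> frac x v} \<subseteq> {v. v < ?n \<and> frac ?y v}"
  proof safe
    fix v assume "v < ?n" and v: "frac x v"
    then obtain k s where ks: "v = k * 9 + s" "k < m" "s < 9" using vertex_cases by blast
    then have "s \<in> lfrac (loc F k)"
      using extreme_frac_subset[OF good] x v unfolding solver_ok_def by blast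
    then have "frac (Y k) s" using Y[OF ks(2)] unfolding witness_def by blast
    then show "frac ?y v" using ks glue_vertex[OF ks(2,3), of Y] by (simp add: frac_def)
  qed
  ultimately have "{v. v < ?n \<and> frac x v} = {v. v < ?n \<and> frac ?y v}"
    unfolding nfrac_def by (intro card_seteq) auto
  then have "frac x (i * 9 + t) \<longleftrightarrow> frac ?y (i * 9 + t)" using vertex_less[OF i t] by blast
  also have "\<dots> \<longleftrightarrow> frac (Y i) t" using glue_vertex[OF i t, of Y] by (simp add: frac_def)
  also have "\<dots> \<longleftrightarrow> t \<in> lfrac (loc F i)" using Y[OF i] t unfolding witness_def by blast
  finally show ?thesis .
qed

text \<open>Vertex 0 is fractional in both unresolved states.\<close>

lemma solver_integral_resolved:
  assumes good: "good m F" and x: "solver_ok (m * 9) (copies m) F x" and int: "integral (m * 9) x"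
    and i: "i < m"
  shows "resolved (loc F i)"
proof -
  have "\<not> frac x (i * 9 + 0)"
  proof -
    have "i * 9 + 0 < m * 9" using i by simp
    then have "x (i * 9 + 0) = 0 \<or> x (i * 9 + 0) = 1" using int unfolding integral_def by blast
    then show ?thesis by (auto simp: frac_def)
  qed
  then have "0 \<notin> lfrac (loc F i)" using solver_frac[OF good x i, of 0] by simp
  then show ?thesis using good i by (auto simp: good_def typed_def lfrac_def split: if_splits)
qed

lemma frac_unfixed:
  assumes x: "solver_ok n E F x" and j: "j < n" "frac x j"
  shows "F j = None"
proof (rule ccontr)
  assume "F j \<noteq> None"
  then obtain b where "F j = Some b" by auto
  then have "x j = 0 \<or> x j = 1"
    using x j by (cases b) (auto simp: solver_ok_def lp_optimal_def lp_feas_def)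
  then show False using j by (auto simp: frac_def)
qed


section \<open>Tree sizes for disjoint copies\<close>

lemma prod_loc_upd:
  assumes "i < m" "t < 9"
  shows "(\<Prod>k<m. w (loc (F(i * 9 + t := b)) k)) =
     w ((loc F i)(t := b)) * (\<Prod>k\<in>{..<m} - {i}. w (loc F k) :: nat)"
  using assms by (subst prod.remove[of _ i]) (auto simp: loc_upd intro!: prod.cong)

lemma sum_loc_upd:
  assumes "i < m" "t < 9"
  shows "(\<Sum>k<m. h (loc (F(i * 9 + t := b)) k)) =
     h ((loc F i)(t := b)) + (\<Sum>k\<in>{..<m} - {i}. h (loc F k) :: real)"
  using assms by (subst sum.remove[of _ i]) (auto simp: loc_upd intro!: sum.cong)

lemma untouched_loc_None: "untouched (loc (\<lambda>_. None) i)"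
  by (simp add: untouched_def loc_def)

text \<open>Branching acts on one copy at a time, so leaf counts multiply over the copies.
  \<open>T\<close> holds at the local states that the rule reaches, \<open>w\<close> counts the
  leaves below such a state, and \<open>r\<close> is the count for an untouched copy.\<close>

lemma copies_tree_size:
  fixes w :: "fixing \<Rightarrow> nat"
  assumes typed: "\<And>f. T f \<Longrightarrow> typed f" and T: "\<And>f. untouched f \<Longrightarrow> T f"
    and w_untouched: "\<And>f. untouched f \<Longrightarrow> w f = r"
    and w_resolved: "\<And>f. resolved f \<Longrightarrow> w f = 1"
    and branch: "\<And>F x j. \<forall>i<m. T (loc F i) \<Longrightarrow> solver_ok (m * 9) (copies m) F x \<Longrightarrow>
        rule (m * 9) (copies m) F x j \<Longrightarrow> frac x j \<and>
        (\<exists>i<m. \<exists>t<9. j = i * 9 + t \<and> (\<forall>b. T ((loc F i)(t := Some b))) \<and>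
           w ((loc F i)(t := Some False)) + w ((loc F i)(t := Some True)) = w (loc F i))"
    and tree: "bb_tree (m * 9) (copies m) rule t"
  shows "t + 1 = 2 * r ^ m"
proof -
  let ?Good = "\<lambda>F. \<forall>i<m. T (loc F i)" and ?W = "\<lambda>F. \<Prod>k<m. w (loc F k)"
  have good: "good m F" if "?Good F" for F using that typed by (simp add: good_def)
  have "t + 1 = 2 * ?W (\<lambda>_. None)"
  proof (rule bb_tree_size[where Good = ?Good and opt = "ereal (real m * 5)" and W = ?W, OF _ _ _ _ _ tree])
    show "?Good (\<lambda>_. None)" using T untouched_loc_None by blast
    show "ereal (real m * 5) \<noteq> \<infinity>" by simp
    show "lp_val (m * 9) (copies m) F \<le> ereal (real m * 5)" if "?Good F" for F
    proof -
      \<comment> \<open>A copy costs at most 5, so \<open>5 * m\<close> bounds every LP value on the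
        way and is reached once all copies are resolved.\<close>
      have "(\<Sum>i<m. lcost (loc F i)) \<le> (\<Sum>i<m. 5)" by (rule sum_mono) (simp add: lcost_def)
      then show ?thesis using lp_val_good[OF good[OF that]] by simp
    qed
    show "?W F = 1 \<and> lp_val (m * 9) (copies m) F = ereal (real m * 5)"
      if F: "?Good F" and x: "solver_ok (m * 9) (copies m) F x" "integral (m * 9) x" for F x
    proof -
      have res: "resolved (loc F i)" if "i < m" for i
        using solver_integral_resolved[OF good[OF F] x that] .
      then have "(\<Sum>i<m. lcost (loc F i)) = (\<Sum>i<m. 5)" by (intro sum.cong) (auto simp: lcost_def)
      moreover have "?W F = 1" using res w_resolved by (intro prod.neutral) auto
      ultimately show ?thesis using lp_val_good[OF good[OF F]] by simp
    qed
    show "F j = None \<and> (\<forall>b. ?Good (F(j := Some b))) \<and>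
        ?W (F(j := Some False)) + ?W (F(j := Some True)) = ?W F"
      if F: "?Good F" and x: "solver_ok (m * 9) (copies m) F x"
        and rule: "rule (m * 9) (copies m) F x j" for F x j
    proof -
      obtain i t where i: "i < m" and t: "t < 9" and j: "j = i * 9 + t" and fr: "frac x j"
        and TT: "\<forall>b. T ((loc F i)(t := Some b))"
        and ww: "w ((loc F i)(t := Some False)) + w ((loc F i)(t := Some True)) = w (loc F i)"
        using branch[OF F x rule] by blast
      have "F j = None" using frac_unfixed[OF x _ fr] vertex_less[OF i t] j by simp
      moreover have "?Good (F(j := Some b))" for b using F TT t by (simp add: j loc_upd)
      moreover have "?W F = w (loc F i) * (\<Prod>k\<in>{..<m} - {i}. w (loc F k))"
        using i by (intro prod.remove) auto
      then have "?W (F(j := Some False)) + ?W (F(j := Some True)) = ?W F"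
        unfolding j prod_loc_upd[OF i t] using ww by (simp flip: distrib_right)
      ultimately show ?thesis by blast
    qed
  qed
  also have "?W (\<lambda>_. None) = r ^ m" using w_untouched untouched_loc_None by simp
  finally show ?thesis .
qed

section \<open>The greedy rule\<close>

definition nbrs :: "nat \<Rightarrow> nat set" where
  "nbrs t = {s. (t, s) \<in> gadget \<or> (s, t) \<in> gadget}"

lemma nbrs_hub: "nbrs 3 = {0, 4, 5, 7}"
  by (auto simp: nbrs_def gadget_def)

lemma finite_nbrs: "finite (nbrs t)"
  by (rule finite_subset[of _ "{..<9}"]) (auto simp: nbrs_def gadget_def)

lemma card_nbrs_le:
  assumes "t < 9" "t \<noteq> 3" shows "card (nbrs t) \<le> 3"
proof -
  have "nbrs 0 = {1, 2, 3}" "nbrs 1 = {0, 2}" "nbrs 2 = {0, 1}" "nbrs 4 = {3}" "nbrs 5 = {3, 6}"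
    "nbrs 6 = {5}" "nbrs 7 = {3, 8}" "nbrs 8 = {7}"
    by (auto simp: nbrs_def gadget_def)
  then have "\<forall>t<9. t \<noteq> 3 \<longrightarrow> card (nbrs t) \<le> 3" unfolding all_less_9 by simp
  then show ?thesis using assms by blast
qed

lemma edge_copies_iff:
  assumes "i < m" "t < 9"
  shows "{i * 9 + t, u} \<in> copies m \<longleftrightarrow> (\<exists>s\<in>nbrs t. u = i * 9 + s)"
proof
  assume "{i * 9 + t, u} \<in> copies m"
  then obtain k a b where k: "k < m" "(a, b) \<in> gadget" "{i * 9 + t, u} = {k * 9 + a, k * 9 + b}"
    unfolding copies_def by blast
  have inj: "i = k \<and> t = c" if "i * 9 + t = k * 9 + c" "c < 9" for c
    using arg_cong[OF that(1), of "\<lambda>v. v div 9"] arg_cong[OF that(1), of "\<lambda>v. v mod 9"] that(2) assms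
    by simp
  have "a < 9" "b < 9" using gadget_less[OF k(2)] by auto
  from k(3) consider "i * 9 + t = k * 9 + a" "u = k * 9 + b" | "i * 9 + t = k * 9 + b" "u = k * 9 + a"
    by (auto simp: doubleton_eq_iff)
  then show "\<exists>s\<in>nbrs t. u = i * 9 + s"
  proof cases
    case 1
    then show ?thesis using inj[OF 1(1) \<open>a < 9\<close>] k(2) by (auto simp: nbrs_def)
  next
    case 2
    then show ?thesis using inj[OF 2(1) \<open>b < 9\<close>] k(2) by (auto simp: nbrs_def)
  qed
next
  assume "\<exists>s\<in>nbrs t. u = i * 9 + s"
  then obtain s where "u = i * 9 + s" "(t, s) \<in> gadget \<or> (s, t) \<in> gadget"
    unfolding nbrs_def by blast
  then show "{i * 9 + t, u} \<in> copies m" using assms(1) unfolding copies_def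
    by (auto simp: doubleton_eq_iff)
qed

lemma frac_nbrs_copies:
  assumes "i < m" "t < 9"
  shows "frac_nbrs (m * 9) (copies m) x (i * 9 + t) = card {s \<in> nbrs t. frac x (i * 9 + s)}"
proof -
  have lt: "s < 9" if "s \<in> nbrs t" for s using that gadget_less unfolding nbrs_def by force
  have "{u. u < m * 9 \<and> {i * 9 + t, u} \<in> copies m \<and> frac x u}
      = (\<lambda>s. i * 9 + s) ` {s \<in> nbrs t. frac x (i * 9 + s)}"
    using edge_copies_iff[OF assms] vertex_less[OF assms(1) lt] by auto
  then show ?thesis unfolding frac_nbrs_def by (simp add: card_image inj_on_def)
qed

text \<open>In an untouched copy everything is fractional, so the hub scores 4 and every other
  vertex at most 3. With only the hub fixed, to 1, just the triangle is fractional.\<close>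

lemma greedy_choice:
  assumes good: "good m F" and x: "solver_ok (m * 9) (copies m) F x"
    and j: "greedy_rule (m * 9) (copies m) F x j"
  shows "\<exists>i<m. (untouched (loc F i) \<and> j = i * 9 + 3) \<or> (hub_only (loc F i) \<and> (\<exists>t<3. j = i * 9 + t))"
proof -
  have "j < m * 9" and fr: "frac x j"
    and max: "\<And>i. i < m * 9 \<Longrightarrow> frac x i \<Longrightarrow>
      frac_nbrs (m * 9) (copies m) x i \<le> frac_nbrs (m * 9) (copies m) x j"
    using j by (auto simp: greedy_rule_def)
  then obtain i t where it: "j = i * 9 + t" "i < m" "t < 9" using vertex_cases by blast
  have tf: "t \<in> lfrac (loc F i)" using fr solver_frac[OF good x it(2,3)] it(1) by simp
  show ?thesis
  proof (cases "untouched (loc F i)")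
    case True
    have fr9: "frac x (i * 9 + s)" if "s < 9" for s
      using solver_frac[OF good x it(2) that] True that by (simp add: lfrac_def)
    have "{s \<in> nbrs 3. frac x (i * 9 + s)} = {0, 4, 5, 7}"
      using fr9[of 0] fr9[of 4] fr9[of 5] fr9[of 7] unfolding nbrs_hub by auto
    then have "4 = frac_nbrs (m * 9) (copies m) x (i * 9 + 3)"
      using frac_nbrs_copies[OF it(2), of 3] by simp
    also have "\<dots> \<le> frac_nbrs (m * 9) (copies m) x j"
      using max vertex_less[OF it(2)] fr9 by simp
    also have "\<dots> \<le> card (nbrs t)"
      using frac_nbrs_copies[OF it(2,3)] it(1) by (simp add: card_mono finite_nbrs)
    finally have "t = 3" using card_nbrs_le[OF it(3)] by linarith
    then show ?thesis using True it by blast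
  next
    case False
    then show ?thesis using tf it by (auto simp: lfrac_def split: if_splits)
  qed
qed

text \<open>An untouched copy has 1 + 2 leaves: hub at 0 resolves it, and hub at 1 leaves a triangle
  vertex to branch on.\<close>

lemma greedy_tree_size:
  assumes "bb_tree (m * 9) (copies m) greedy_rule t"
  shows "t + 1 = 2 * 3 ^ m"
proof (rule copies_tree_size[where T = typed and w = "\<lambda>f. if untouched f then 3 else if hub_only f then 2 else 1",
      OF _ _ _ _ _ assms])
  fix F x j
  assume F: "\<forall>i<m. typed (loc F i)" and x: "solver_ok (m * 9) (copies m) F x"
    and j: "greedy_rule (m * 9) (copies m) F x j"
  let ?w = "\<lambda>f. if untouched f then 3 else if hub_only f then 2 else 1::nat"
  have w1: "?w f = 1" if "resolved f" for f using that resolved_not by auto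
  have w2: "?w f = 2" if "hub_only f" for f using that resolved_not by auto
  have fr: "frac x j" using j by (simp add: greedy_rule_def)
  obtain i where i: "i < m" and "(untouched (loc F i) \<and> j = i * 9 + 3) \<or>
      (hub_only (loc F i) \<and> (\<exists>t<3. j = i * 9 + t))"
    using greedy_choice[OF _ x j] F unfolding good_def by blast
  then consider "untouched (loc F i)" "j = i * 9 + 3"
    | t where "hub_only (loc F i)" "t < 3" "j = i * 9 + t" by blast
  then show "frac x j \<and> (\<exists>i<m. \<exists>t<9. j = i * 9 + t \<and> (\<forall>b. typed ((loc F i)(t := Some b))) \<and>
           ?w ((loc F i)(t := Some False)) + ?w ((loc F i)(t := Some True)) = ?w (loc F i))"
  proof cases
    case 1
    note u = upd_hub_untouched[OF 1(1)]
    have "typed ((loc F i)(3 := Some b))" for b using u by (cases b) (auto simp: typed_def)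
    moreover have "?w ((loc F i)(3 := Some False)) + ?w ((loc F i)(3 := Some True)) = ?w (loc F i)"
      unfolding w1[OF u(2)] w2[OF u(1)] using 1 by simp
    ultimately show ?thesis using fr i 1(2) by (intro conjI exI[of _ i] exI[of _ 3]) auto
  next
    case (2 t)
    have r: "resolved ((loc F i)(t := Some b))" for b using upd_triangle 2 by blast
    then have "typed ((loc F i)(t := Some b))" for b by (simp add: typed_def)
    moreover have "?w ((loc F i)(t := Some False)) + ?w ((loc F i)(t := Some True)) = ?w (loc F i)"
      unfolding w1[OF r] w2[OF 2(1)] by simp
    ultimately show ?thesis using fr i 2(2,3) by (intro conjI exI[of _ i] exI[of _ t]) auto
  qed
qed (use resolved_not in \<open>auto simp: typed_def\<close>)

section \<open>Strong branching with product score\<close>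

lemma strong_choice:
  assumes good: "good m F" and nohub: "\<forall>i<m. \<not> hub_only (loc F i)"
    and x: "solver_ok (m * 9) (copies m) F x" and j: "strong_rule (m * 9) (copies m) F x j"
  shows "\<exists>i<m. \<exists>t<3. untouched (loc F i) \<and> j = i * 9 + t"
proof -
  let ?lp = "lp_val (m * 9) (copies m)" and ?sc = "sb_score (m * 9) (copies m) F"
  have "j < m * 9" and fr: "frac x j"
    and max: "\<And>i. i < m * 9 \<Longrightarrow> frac x i \<Longrightarrow> ?sc i \<le> ?sc j"
    using j by (auto simp: strong_rule_def)
  then obtain i t where it: "j = i * 9 + t" "i < m" "t < 9" using vertex_cases by blast
  have "t \<in> lfrac (loc F i)" using fr solver_frac[OF good x it(2,3)] it(1) by simp
  \<comment> \<open>Without copies in state \<open>hub_only\<close>, every fractional vertex lies in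
    an untouched copy.\<close>
  then have u: "untouched (loc F i)" using nohub it by (auto simp: lfrac_def split: if_splits)
  then have nr: "\<not> resolved (loc F i)" using resolved_not by blast
  define R where "R = (\<Sum>k\<in>{..<m} - {i}. lcost (loc F k))"
  have sum_F: "(\<Sum>k<m. lcost (loc F k)) = 9/2 + R"
    using it(2) nr unfolding R_def by (subst sum.remove[of _ i]) (auto simp: lcost_def)
  have lp_F: "?lp F = ereal (9/2 + R)" using lp_val_good[OF good] sum_F by simp
  have "t < 3"
  proof (rule ccontr)
    assume "\<not> t < 3"
    have "?lp (F(i * 9 + 0 := Some b)) = ereal (5 + R)" for b
    proof -
      have r: "resolved ((loc F i)(0 := Some b))" using upd_triangle[of "loc F i" 0 b] u by simp
      then have "good m (F(i * 9 + 0 := Some b))"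
        using good by (intro good_upd) (auto simp: typed_def)
      then show ?thesis
        unfolding R_def using sum_loc_upd[OF it(2), of 0 lcost F "Some b"] r
        by (subst lp_val_good) (auto simp: lcost_def)
    qed
    \<comment> \<open>Both children raise the LP value by 1/2; the contribution \<open>R\<close> of
      the other copies cancels.\<close>
    then have "?sc (i * 9 + 0) = ereal (1/4)" unfolding sb_score_def lp_F by simp
    moreover have "frac x (i * 9 + 0)"
      using solver_frac[OF good x it(2), of 0] u by (simp add: lfrac_def)
    moreover have "i * 9 + 0 < m * 9" using it(2) by simp
    ultimately have pos: "ereal (1/4) \<le> ?sc j" using max by metis
    obtain b y where y: "lfeas ((loc F i)(t := Some b)) y" "(\<Sum>t<9. y t) = 9/2"
      using free_child[OF u _ it(3)] \<open>\<not> t < 3\<close> by force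
    obtain Y where Y: "\<forall>k<m. witness (loc F k) (Y k)" using good_witness[OF good] .
    \<comment> \<open>Fixing \<open>t\<close> need not lead to a \<open>typed\<close> state, so
      \<open>lp_val_good\<close> is replaced by the explicit point \<open>y\<close> and the bound
      9/2 that holds under all fixings.\<close>
    have "?lp (F(j := Some b)) = ereal (\<Sum>k<m. lcost (loc F k))"
    proof (rule lp_val_copies[where Y = "Y(i := y)"])
      fix k assume k: "k < m"
      have "lfeas (loc F k) (Y k)" "(\<Sum>t<9. Y k t) = lcost (loc F k)"
        using Y k by (auto simp: witness_def)
      then show "lfeas (loc (F(j := Some b)) k) ((Y(i := y)) k)"
        "(\<Sum>t<9. (Y(i := y)) k t) = lcost (loc F k)"
        using y nr unfolding it(1) loc_upd[OF it(3)] by (auto simp: lcost_def)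
      show "lcost (loc F k) \<le> (\<Sum>t<9. z t)" if z: "lfeas (loc (F(j := Some b)) k) z" for z
      proof (cases "k = i")
        case True
        then show ?thesis using lfeas_sum_ge[OF z] nr by (simp add: lcost_def)
      next
        case False
        then show ?thesis using z lcost_le_sum unfolding it(1) loc_upd[OF it(3)] by simp
      qed
    qed
    then have "?lp (F(j := Some b)) - ?lp F = 0" using sum_F lp_F by simp
    \<comment> \<open>One zero factor suffices, whatever the other child costs.\<close>
    then have "?sc j = 0" unfolding sb_score_def by (cases b) auto
    then show False using pos by simp
  qed
  then show ?thesis using u it by blast
qed

text \<open>Both children at a triangle vertex are resolved, so a copy has 1 + 1 leaves and the
  state \<open>hub_only\<close> never arises.\<close>

lemma strong_tree_size:
  assumes "bb_tree (m * 9) (copies m) strong_rule t"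
  shows "t + 1 = 2 * 2 ^ m"
proof (rule copies_tree_size[where T = "\<lambda>f. untouched f \<or> resolved f" and w = "\<lambda>f. if untouched f then 2 else 1",
      OF _ _ _ _ _ assms])
  fix F x j
  assume F: "\<forall>i<m. untouched (loc F i) \<or> resolved (loc F i)"
    and x: "solver_ok (m * 9) (copies m) F x" and j: "strong_rule (m * 9) (copies m) F x j"
  have good: "good m F" using F by (auto simp: good_def typed_def)
  have "\<forall>i<m. \<not> hub_only (loc F i)" using F resolved_not by blast
  then obtain i t where i: "i < m" "t < 3" "untouched (loc F i)" "j = i * 9 + t"
    using strong_choice[OF good _ x j] by blast
  have r: "resolved ((loc F i)(t := Some b))" for b using upd_triangle i by blast
  have "\<not> untouched ((loc F i)(t := Some b))" for b using r resolved_not by blast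
  then show "frac x j \<and> (\<exists>i<m. \<exists>t<9. j = i * 9 + t \<and>
      (\<forall>b. untouched ((loc F i)(t := Some b)) \<or> resolved ((loc F i)(t := Some b))) \<and>
      (if untouched ((loc F i)(t := Some False)) then 2 else 1) +
      (if untouched ((loc F i)(t := Some True)) then 2 else 1::nat) = (if untouched (loc F i) then 2 else 1))"
    using r i j by (intro conjI exI[of _ i] exI[of _ t]) (auto simp: strong_rule_def)
qed (use resolved_not in \<open>auto simp: typed_def\<close>)

text \<open>An upper bound is enough, as the gap only enters the exponent of a lower bound on the
  tree size.\<close>

lemma gap_copies_le: "gap (m * 9) (copies m) \<le> real m / 2"
proof -
  let ?y = "\<lambda>t::nat. if t \<in> {0, 1, 3, 5, 7} then 1 else 0 :: real"
  let ?x = "glue m (\<lambda>_. ?y)"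
  have "lfeas (loc (\<lambda>_. None) i) ?y" for i by (simp add: local_defs loc_def)
  then have "?x \<in> lp_feas (m * 9) (copies m) (\<lambda>_. None)" by (rule glue_feas)
  moreover have "integral (m * 9) ?x" by (simp add: integral_def glue_def)
  moreover have "obj (m * 9) ?x = 5 * real m" unfolding glue_obj by (simp add: sum_less_9)
  ultimately have "ip_val (m * 9) (copies m) \<le> ereal (5 * real m)"
    unfolding ip_val_def by (metis (mono_tags, lifting) INF_lower mem_Collect_eq)
  \<comment> \<open>Plus infinity is excluded, and minus infinity would be sent to 0, so the bound
    survives the conversion.\<close>
  then have "real_of_ereal (ip_val (m * 9) (copies m)) \<le> 5 * real m"
    by (cases "ip_val (m * 9) (copies m)") auto
  moreover have "lp_val (m * 9) (copies m) (\<lambda>_. None) = ereal (9/2 * real m)"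
  proof -
    have "\<not> resolved (loc (\<lambda>_. None) i)" for i
      using untouched_loc_None resolved_not by blast
    moreover have "good m (\<lambda>_. None)" using untouched_loc_None by (auto simp: good_def typed_def)
    ultimately show ?thesis by (simp add: lp_val_good lcost_def)
  qed
  ultimately show ?thesis unfolding gap_def by simp
qed

theorem theorem2p4:
  "\<exists>c::real. c > 2 \<and> (\<exists>\<delta>::real. \<delta> > 0 \<and>
     (\<exists>(N::nat \<Rightarrow> nat) (G::nat \<Rightarrow> nat set set).
        filterlim N at_top sequentially \<and> (\<forall>k. vc_graph (N k) (G k)) \<and>
        (\<forall>k tG tS. bb_tree (N k) (G k) greedy_rule tG \<longrightarrow>
                   bb_tree (N k) (G k) strong_rule tS \<longrightarrow>
           real tG \<ge> 2 powr (\<delta> * real (N k)) * real tS \<and>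
           real tG \<ge> 2 powr (c * gap (N k) (G k)))))"
proof -
  \<comment> \<open>With gap at most \<open>k / 2\<close>, this \<open>c\<close> makes the bound
    \<open>3 ^ k\<close>; \<open>\<delta>\<close> spreads the ratio \<open>(3/2) ^ k\<close> over
    \<open>9 * k\<close> vertices.\<close>
  define c :: real where "c = 2 * log 2 3"
  define \<delta> :: real where "\<delta> = log 2 (3/2) / 9"
  have "c > 2" by (simp add: c_def)
  have "\<delta> > 0" by (simp add: \<delta>_def)
  have pow: "2 powr (log 2 a * real k) = a ^ k" if "a > 0" for a :: real and k
    using that by (simp add: powr_realpow flip: powr_powr)
  have lim: "filterlim (\<lambda>k. k * 9 :: nat) at_top sequentially"
    by (rule filterlim_at_top_mono[OF filterlim_ident]) simp
  have "real tG \<ge> 2 powr (\<delta> * real (k * 9)) * real tS \<and> real tG \<ge> 2 powr (c * gap (k * 9) (copies k))"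
    if tG: "bb_tree (k * 9) (copies k) greedy_rule tG"
      and tS: "bb_tree (k * 9) (copies k) strong_rule tS" for k tG tS
  proof -
    have "real (tG + 1) = real (2 * 3 ^ k)" using greedy_tree_size[OF tG] by simp
    then have G: "real tG = 2 * 3 ^ k - 1" by simp
    have "real (tS + 1) = real (2 * 2 ^ k)" using strong_tree_size[OF tS] by simp
    then have S: "real tS = 2 * 2 ^ k - 1" by simp
    have "2 powr (\<delta> * real (k * 9)) = (3/2) ^ k" using pow[of "3/2" k] by (simp add: \<delta>_def)
    then have "2 powr (\<delta> * real (k * 9)) * real tS = 2 * ((3/2) ^ k * 2 ^ k) - (3/2) ^ k"
      unfolding S by (simp add: algebra_simps)
    also have "\<dots> = 2 * 3 ^ k - (3/2) ^ k" by (simp flip: power_mult_distrib)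
    \<comment> \<open>The subtracted \<open>(3/2) ^ k\<close> is at least the 1 subtracted in
      \<open>tG\<close>.\<close>
    also have "\<dots> \<le> real tG" unfolding G by simp
    finally have 1: "2 powr (\<delta> * real (k * 9)) * real tS \<le> real tG" .
    have "c * gap (k * 9) (copies k) \<le> c * (real k / 2)"
      using gap_copies_le \<open>c > 2\<close> by (intro mult_left_mono) auto
    then have "2 powr (c * gap (k * 9) (copies k)) \<le> 2 powr (log 2 3 * real k)"
      by (simp add: c_def)
    also have "\<dots> = 3 ^ k" using pow[of 3 k] by simp
    also have "\<dots> \<le> real tG" unfolding G using one_le_power[of "3::real" k] by simp
    finally show ?thesis using 1 by simp
  qed
  then show ?thesis using \<open>c > 2\<close> \<open>\<delta> > 0\<close> lim vc_graph_copies
    by (intro exI[of _ c] conjI exI[of _ \<delta>] exI[of _ "\<lambda>k. k * 9"] exI[of _ copies]) auto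
qed

end
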